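(* Let $\mathbb{T}$ be a finite tree with vertex set $T$. Then the following are equivalent. \begin{enumerate} \item $\mathbb{T}$ is a core; \item $\operatorname{End}(\mathbb{T})=\{\operatorname{id}_T\}$; \item $\operatorname{AC}_{\mathbb{T}}(\mathbb{T})$ terminates such that the list for each vertex contains a single element. \end{enumerate}
   Context: A digraph is a pair $\mathbb{H}=(H;E)$ with $H$ a nonempty finite set and $E\subseteq H^2$. A homomorphism from a digraph $\mathbb{G}$ to a digraph $\mathbb{H}$ is a map $h\colon G\to H$ such that $(h(x),h(y))\in E(\mathbb{H})$ for every $(x,y)\in E(\mathbb{G})$. An endomorphism of $\mathbb{H}$ is a homomorphism from $\mathbb{H}$ to $\mathbb{H}$, and $\operatorname{End}(\mathbb{H})$ is the set of endomorphisms of $\mathbb{H}$. A finite digraph is a core if all its endomorphisms are injective. An orientation of an undirected graph is obtained by replacing each edge $\{x,y\}$ by exactly one of $(x,y)$, $(y,x)$. A "tree" means a digraph that is an orientation of a finite undirected tree (connected acyclic graph). The arc-consistency procedure $\operatorname{AC}_{\mathbb{H}}(\mathbb{G})$, for finite digraphs $\mathbb{G},\mathbb{H}$, maintains a list $L(x)\subseteq H$ for each $x\in G$, initialized with $L(x)=H$. As long as possible it applies the following rules for edges $(x,y)\in E(\mathbb{G})$: remove $u$ from $L(x)$ if there is no $v\in L(y)$ with $(u,v)\in E(\mathbb{H})$; remove $v$ from $L(y)$ if there is no $u\in L(x)$ with $(u,v)\in E(\mathbb{H})$. It rejects if some list becomes empty; otherwise it terminates when no list changes any more. *)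

theory Defs
  imports "HOL-Library.FuncSet" "Graph_Theory.Digraph_Component"
begin

definition digraph_homs :: "'a pair_pre_digraph \<Rightarrow> 'b pair_pre_digraph \<Rightarrow> ('a \<Rightarrow> 'b) set" where
  "digraph_homs G H =
     {h \<in> pverts G \<rightarrow>\<^sub>E pverts H. \<forall>(x, y) \<in> parcs G. (h x, h y) \<in> parcs H}"

definition endomorphisms :: "'a pair_pre_digraph \<Rightarrow> ('a \<Rightarrow> 'a) set" where
  "endomorphisms H = digraph_homs H H"

definition is_core :: "'a pair_pre_digraph \<Rightarrow> bool" where
  "is_core H \<longleftrightarrow> (\<forall>h \<in> endomorphisms H. inj_on h (pverts H))"

text \<open>
  An undirected graph is a symmetric, loop-free digraph (\<^locale>\<open>pair_graph\<close>). There, a closed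
  arc walk of length two running back and forth along one edge counts as a \<^const>\<open>pre_digraph.cycle\<close>,
  so the cycles of the undirected graph are those of length at least three. Note that the
  predicates \<^const>\<open>forest\<close> and \<^const>\<open>tree\<close> of the library exclude directed cycles only, and
  hence cannot be used here. Connectedness includes that there is at least one vertex.
\<close>

definition undirected_tree :: "'a pair_pre_digraph \<Rightarrow> bool" where
  "undirected_tree U \<longleftrightarrow>
     pair_graph U \<and> connected (with_proj U) \<and>
     \<not> (\<exists>p. pre_digraph.cycle (with_proj U) p \<and> length p \<ge> 3)"

definition orientation_of :: "'a pair_pre_digraph \<Rightarrow> 'a pair_pre_digraph \<Rightarrow> bool" where
  "orientation_of G U \<longleftrightarrow>
     pverts G = pverts U \<and> parcs G \<subseteq> parcs U \<and>
     (\<forall>(x, y) \<in> parcs U. (x, y) \<in> parcs G \<longleftrightarrow> (y, x) \<notin> parcs G)"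

definition oriented_tree :: "'a pair_pre_digraph \<Rightarrow> bool" where
  "oriented_tree T \<longleftrightarrow> (\<exists>U. undirected_tree U \<and> orientation_of T U)"

text \<open>
  The arc-consistency procedure for \<open>G\<close> and \<open>H\<close> as a transition system on the families of lists.
  The values of \<open>L\<close> outside \<^term>\<open>pverts G\<close> are irrelevant.
\<close>

inductive ac_step ::
  "'a pair_pre_digraph \<Rightarrow> 'b pair_pre_digraph \<Rightarrow> ('a \<Rightarrow> 'b set) \<Rightarrow> ('a \<Rightarrow> 'b set) \<Rightarrow> bool"
  for G H where
  remove_tail: "ac_step G H L (L(x := L x - {u}))"
    if "(x, y) \<in> parcs G" "u \<in> L x" "\<not> (\<exists>v \<in> L y. (u, v) \<in> parcs H)"
| remove_head: "ac_step G H L (L(y := L y - {v}))"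
    if "(x, y) \<in> parcs G" "v \<in> L y" "\<not> (\<exists>u \<in> L x. (u, v) \<in> parcs H)"

definition ac_reachable ::
  "'a pair_pre_digraph \<Rightarrow> 'b pair_pre_digraph \<Rightarrow> ('a \<Rightarrow> 'b set) \<Rightarrow> bool" where
  "ac_reachable G H L \<longleftrightarrow> (ac_step G H)\<^sup>*\<^sup>* (\<lambda>_. pverts H) L"

definition ac_rejects :: "'a pair_pre_digraph \<Rightarrow> 'b pair_pre_digraph \<Rightarrow> bool" where
  "ac_rejects G H \<longleftrightarrow> (\<exists>L. ac_reachable G H L \<and> (\<exists>x \<in> pverts G. L x = {}))"

definition ac_terminates_with ::
  "'a pair_pre_digraph \<Rightarrow> 'b pair_pre_digraph \<Rightarrow> ('a \<Rightarrow> 'b set) \<Rightarrow> bool" where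
  "ac_terminates_with G H L \<longleftrightarrow>
     ac_reachable G H L \<and> (\<forall>x \<in> pverts G. L x \<noteq> {}) \<and> \<not> (\<exists>L'. ac_step G H L L')"

text \<open>
  The procedure is nondeterministic, but its outcome does not depend on the order in which the
  rules are applied: it either rejects, or it terminates with a unique family of lists.
\<close>

lemma ac_stable_below_reachable:
  assumes M: "\<not> (\<exists>M'. ac_step G H M M')" "\<And>x. M x \<subseteq> pverts H"
    and L: "ac_reachable G H L"
  shows "M x \<subseteq> L x"
proof -
  have "\<forall>x. M x \<subseteq> L x"
    using L unfolding ac_reachable_def
  proof (induction rule: rtranclp_induct)
    case base
    then show ?case using M(2) by simp
  next
    case (step K L)
    have tail: "\<exists>v \<in> M y. (u, v) \<in> parcs H" if "(x, y) \<in> parcs G" "u \<in> M x" for x y u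
      using M(1) ac_step.remove_tail[of x y G u M H] that by blast
    have head: "\<exists>u \<in> M x. (u, v) \<in> parcs H" if "(x, y) \<in> parcs G" "v \<in> M y" for x y v
      using M(1) ac_step.remove_head[of x y G v M H] that by blast
    from step.hyps(2) show ?case
    proof cases
      case (remove_tail x y u)
      then have "u \<notin> M x" using tail[of x y u] step.IH by blast
      then show ?thesis using remove_tail step.IH by auto
    next
      case (remove_head x y v)
      then have "v \<notin> M y" using head[of x y v] step.IH by blast
      then show ?thesis using remove_head step.IH by auto
    qed
  qed
  then show ?thesis by blast
qed

lemma ac_reachable_subset: "ac_reachable G H L \<Longrightarrow> L x \<subseteq> pverts H"
proof -
  assume "ac_reachable G H L"
  then have "\<forall>x. L x \<subseteq> pverts H"
    unfolding ac_reachable_def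
    by (induction rule: rtranclp_induct) (fastforce elim!: ac_step.cases split: if_splits)+
  then show ?thesis by blast
qed

lemma ac_terminates_with_unique:
  "ac_terminates_with G H L \<Longrightarrow> ac_terminates_with G H M \<Longrightarrow> L = M"
  unfolding ac_terminates_with_def
  by (intro ext subset_antisym) (metis ac_stable_below_reachable ac_reachable_subset)+

lemma ac_terminates_with_not_rejects:
  assumes "ac_terminates_with G H L"
  shows "\<not> ac_rejects G H"
proof
  assume "ac_rejects G H"
  then obtain K x where K: "ac_reachable G H K" "x \<in> pverts G" "K x = {}"
    unfolding ac_rejects_def by blast
  have "L x \<subseteq> K x"
    using assms K(1) ac_stable_below_reachable[of G H L K x] ac_reachable_subset[of G H L]
    unfolding ac_terminates_with_def by blast
  then show False using assms K unfolding ac_terminates_with_def by auto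
qed

lemma ac_halts:
  assumes G: "pair_fin_digraph G" and H: "finite (pverts H)"
  shows "ac_rejects G H \<or> (\<exists>L. ac_terminates_with G H L)"
proof -
  let ?m = "\<lambda>L. \<Sum>x \<in> pverts G. card (L x)"
  interpret pair_fin_digraph G by (fact G)
  have init: "ac_reachable G H (\<lambda>_. pverts H)" by (simp add: ac_reachable_def)
  obtain L where L: "ac_reachable G H L" and min: "\<And>K. ac_reachable G H K \<Longrightarrow> ?m L \<le> ?m K"
    using ex_has_least_nat[of "ac_reachable G H" "\<lambda>_. pverts H" ?m] init by blast
  have less: "?m (L(x := L x - {u})) < ?m L" if "x \<in> pverts G" "u \<in> L x" for x u
  proof (rule sum_strict_mono_ex1)
    show "finite (pverts G)" by (rule pair_finite_verts)
    have fin: "finite (L z)" for z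
      using finite_subset[OF ac_reachable_subset[OF L] H] .
    show "\<forall>z \<in> pverts G. card ((L(x := L x - {u})) z) \<le> card (L z)"
      using fin by (auto intro!: card_mono)
    show "\<exists>z \<in> pverts G. card ((L(x := L x - {u})) z) < card (L z)"
      using fin that by (intro bexI[of _ x]) (simp_all add: card_Diff1_less del: card_Diff_insert card_Diff_singleton)
  qed
  have "\<not> ac_step G H L L'" for L'
  proof
    assume s: "ac_step G H L L'"
    then have "ac_reachable G H L'"
      using L unfolding ac_reachable_def by (rule rtranclp.rtrancl_into_rtrancl[rotated])
    moreover from s have "?m L' < ?m L"
      by cases (simp_all only: less in_arcsD1 in_arcsD2)
    ultimately show False using min[of L'] by simp
  qed
  then show ?thesis using L unfolding ac_rejects_def ac_terminates_with_def by blast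
qed

end

theory Submission
  imports Defs
begin

text \<open>
  Removing a vertex \<open>x\<close> splits a tree into branches, each containing exactly one neighbour of \<open>x\<close>.

  Every endomorphism \<open>h\<close> of an oriented tree fixes a vertex: otherwise choose an edge \<open>x - y\<close> such
  that \<open>h x\<close> lies in the branch at \<open>x\<close> containing \<open>y\<close> and this branch is as small as possible. By
  minimality \<open>h y\<close> lies on the side of \<open>x\<close>, so \<open>h\<close> exchanges \<open>x\<close> and \<open>y\<close>, which reverses an arc.
  Hence if \<open>h\<close> is not the identity, there is a fixed vertex \<open>v\<close> with a neighbour \<open>u\<close> that is
  moved; applying \<open>h\<close> to the branch of \<open>u\<close> at \<open>v\<close> only yields an endomorphism that
  identifies \<open>u\<close> and \<open>h u\<close>.

  For arc consistency, the images of a vertex under homomorphisms always stay in its list;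
  conversely, every element of a final list is attained by a homomorphism, which
  can be extended greedily from one vertex along the tree.
\<close>

section \<open>Branches of a tree\<close>

text \<open>\<open>E\<close> is the edge relation of the underlying undirected tree. Connectedness
  is phrased as induction along edges; \<open>acyclic\<close> says that distinct neighbours of
  \<open>x\<close> are separated by deleting \<open>x\<close>.\<close>

locale oriented_tree_graph =
  fixes T :: "'a pair_pre_digraph" and E :: "'a rel"
  assumes finite_verts: "finite (pverts T)"
    and nonempty: "pverts T \<noteq> {}"
    and adj_iff: "(u, v) \<in> E \<longleftrightarrow> (u, v) \<in> parcs T \<or> (v, u) \<in> parcs T"
    and adj_verts: "(u, v) \<in> E \<Longrightarrow> u \<in> pverts T"
    and asym: "(u, v) \<in> parcs T \<Longrightarrow> (v, u) \<notin> parcs T"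
    and connected: "\<lbrakk>u \<in> pverts T; u \<in> S; \<And>v w. v \<in> S \<Longrightarrow> (v, w) \<in> E \<Longrightarrow> w \<in> S\<rbrakk> \<Longrightarrow> pverts T \<subseteq> S"
    and acyclic: "\<lbrakk>(x, y) \<in> E; (x, a) \<in> E; (y, a) \<in> (Restr E (- {x}))\<^sup>*\<rbrakk> \<Longrightarrow> a = y"
begin

lemma adj_sym: "(u, v) \<in> E \<Longrightarrow> (v, u) \<in> E"
  by (auto simp: adj_iff)

lemma adj_verts2: "(u, v) \<in> E \<Longrightarrow> v \<in> pverts T"
  using adj_sym adj_verts by blast

lemma arc_verts: "(u, v) \<in> parcs T \<Longrightarrow> u \<in> pverts T \<and> v \<in> pverts T"
  using adj_verts adj_verts2 adj_iff by blast

lemma adj_neq: "(u, v) \<in> E \<Longrightarrow> u \<noteq> v"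
  using asym by (auto simp: adj_iff)

lemma endo_adj:
  assumes "h \<in> endomorphisms T" "(u, v) \<in> E"
  shows "(h u, h v) \<in> E"
  using assms by (auto simp: endomorphisms_def digraph_homs_def adj_iff)

text \<open>For \<open>x = y\<close> this degenerates to \<open>{x}\<close>, hence the assumption
  \<open>x \<noteq> y\<close> in some facts below.\<close>

definition branch :: "'a \<Rightarrow> 'a \<Rightarrow> 'a set" where
  "branch x y = {v. (y, v) \<in> (Restr E (- {x}))\<^sup>*}"

lemma branch_self: "y \<in> branch x y"
  by (simp add: branch_def)

lemma branch_avoids: "v \<in> branch x y \<Longrightarrow> x \<noteq> y \<Longrightarrow> v \<noteq> x"
  unfolding branch_def by (auto elim: rtranclE)

lemma branch_step:
  assumes "v \<in> branch x y" "x \<noteq> y" "(v, w) \<in> E" "w \<noteq> x"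
  shows "w \<in> branch x y"
  using assms branch_avoids[OF assms(1,2)] unfolding branch_def
  by (auto intro: rtrancl_into_rtrancl)

lemma branch_neighbour:
  assumes "(x, y) \<in> E" "(x, a) \<in> E" "a \<in> branch x y"
  shows "a = y"
  using acyclic assms unfolding branch_def by blast

text \<open>A step out of the branch must enter \<open>x\<close>, and acyclicity leaves
  \<open>y\<close> as the only neighbour of \<open>x\<close> inside.\<close>

lemma branch_exit:
  assumes "(x, y) \<in> E" "v \<in> branch x y" "(v, w) \<in> E" "w \<notin> branch x y"
  shows "v = y \<and> w = x"
proof -
  have "w = x" using branch_step[OF assms(2) _ assms(3)] assms(1,4) adj_neq by blast
  then show ?thesis using branch_neighbour[OF assms(1) _ assms(2)] assms(3) adj_sym by blast
qed

lemma branch_induct [consumes 1, case_names self step]: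
  assumes "v \<in> branch x y" "P y"
    and "\<And>v w. \<lbrakk>v \<in> branch x y; P v; (v, w) \<in> E; v \<noteq> x; w \<noteq> x\<rbrakk> \<Longrightarrow> P w"
  shows "P v"
proof -
  have "(y, v) \<in> (Restr E (- {x}))\<^sup>*" using assms(1) by (simp add: branch_def)
  then show ?thesis
  proof (induction rule: rtrancl_induct)
    case base
    show ?case by (rule assms(2))
  next
    case (step v w)
    then show ?case using assms(3)[of v w] by (simp add: branch_def)
  qed
qed

lemma branch_subset_verts: "(x, y) \<in> E \<Longrightarrow> branch x y \<subseteq> pverts T"
proof
  fix v assume "(x, y) \<in> E" "v \<in> branch x y"
  from this(2) show "v \<in> pverts T"
    by (induction rule: branch_induct) (use \<open>(x, y) \<in> E\<close> adj_verts2 in auto)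
qed

text \<open>A walk from \<open>y\<close> avoiding \<open>x\<close> could enter
  \<open>branch y x\<close> only at \<open>x\<close>.\<close>

lemma branch_disjoint:
  assumes "(x, y) \<in> E" "v \<in> branch x y"
  shows "v \<notin> branch y x"
  using assms(2)
proof (induction rule: branch_induct)
  case self
  then show ?case using branch_avoids[of y y x] adj_neq[OF assms(1)] by blast
next
  case (step v w)
  show ?case
    using branch_exit[of y x w v] step assms(1) adj_sym by blast
qed

text \<open>A walk avoiding \<open>y\<close> cannot leave \<open>branch x y\<close>, whose only exit
  is at \<open>y\<close>. Strictness comes from \<open>y\<close> itself. This yields the descent in
  the search for a fixed vertex.\<close>

lemma branch_psubset:
  assumes "(x, y) \<in> E" "(y, z) \<in> E" "z \<noteq> x"
  shows "branch y z \<subset> branch x y"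
proof -
  have "v \<in> branch x y" if "v \<in> branch y z" for v
    using that
  proof (induction rule: branch_induct)
    case self
    show ?case using branch_step[OF branch_self _ assms(2,3)] adj_neq assms(1) by blast
  next
    case (step v w)
    then show ?case using branch_exit[OF assms(1), of v w] by blast
  qed
  moreover have "y \<notin> branch y z" using branch_avoids adj_neq assms(2) by blast
  ultimately show ?thesis using branch_self by blast
qed

text \<open>The vertex \<open>x\<close> together with its branches is closed under
  adjacency.\<close>

lemma ex_branch:
  assumes "x \<in> pverts T" "v \<in> pverts T" "v \<noteq> x"
  obtains y where "(x, y) \<in> E" "v \<in> branch x y"
proof -
  let ?S = "insert x {v. \<exists>y. (x, y) \<in> E \<and> v \<in> branch x y}"
  have "pverts T \<subseteq> ?S"
    using assms(1)
  proof (rule connected)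
    fix v w assume "v \<in> ?S" "(v, w) \<in> E"
    then show "w \<in> ?S"
      using branch_self[of w x] branch_step[of v x _ w] adj_neq by blast
  qed simp
  then show thesis using assms that by blast
qed

section \<open>Endomorphisms of oriented trees\<close>

lemma endo_fixes_vertex:
  assumes h: "h \<in> endomorphisms T"
  shows "\<exists>v \<in> pverts T. h v = v"
proof (rule ccontr)
  assume "\<not> ?thesis"
  then have moves: "h v \<noteq> v" if "v \<in> pverts T" for v using that by blast
  have hV: "h v \<in> pverts T" if "v \<in> pverts T" for v
    using h that by (auto simp: endomorphisms_def digraph_homs_def)
  let ?P = "\<lambda>(x, y). (x, y) \<in> E \<and> h x \<in> branch x y"
  let ?m = "\<lambda>(x, y). card (branch x y)"
  have towards: "\<exists>y. ?P (x, y)" if "x \<in> pverts T" for x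
    using ex_branch[OF that hV moves] that by auto
  then obtain e where "?P e" using nonempty by blast
  then obtain e' where e': "?P e'" "\<And>e. ?P e \<Longrightarrow> ?m e' \<le> ?m e"
    using ex_has_least_nat[of ?P e ?m] by blast
  obtain x y where xy: "e' = (x, y)" by fastforce
  have P: "(x, y) \<in> E" "h x \<in> branch x y" using e'(1) xy by auto
  have y: "y \<in> pverts T" using P(1) adj_verts2 by blast
  obtain z where z: "(y, z) \<in> E" "h y \<in> branch y z" using towards[OF y] by auto
  have "\<not> branch y z \<subset> branch x y"
    using e'(2)[of "(y, z)"] z xy psubset_card_mono[of "branch x y" "branch y z"]
      finite_subset[OF branch_subset_verts[OF P(1)] finite_verts] by auto
  then have "z = x" using branch_psubset[OF P(1) z(1)] by blast
  then have "h y \<notin> branch x y" using z(2) branch_disjoint[OF P(1)] by blast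
  \<comment> \<open>The edge from \<open>h x\<close> to \<open>h y\<close> leaves
    \<open>branch x y\<close>, so it is the exit edge.\<close>
  then have "h x = y" "h y = x"
    using branch_exit[OF P endo_adj[OF h P(1)]] by auto
  then show False
    using P(1) h asym by (fastforce simp: adj_iff endomorphisms_def digraph_homs_def)
qed

text \<open>The only edge between the branch and the rest ends in \<open>v\<close>, where
  \<open>h\<close> and the identity agree; so each arc is mapped either as by \<open>h\<close> or as
  by the identity.\<close>

lemma fold_branch:
  assumes h: "h \<in> endomorphisms T" and vu: "(v, u) \<in> E" and fixed: "h v = v"
  shows "(\<lambda>x. if x \<in> branch v u then h x else (\<lambda>x \<in> pverts T. x) x) \<in> endomorphisms T" (is "?g \<in> _")
proof -
  define g where "g = ?g"
  have g: "g x = (if x \<in> branch v u then h x else x)" if "x \<in> pverts T" for x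
    using that by (simp add: g_def)
  have "(g a, g b) \<in> parcs T" if ab: "(a, b) \<in> parcs T" for a b
  proof -
    have E: "(a, b) \<in> E" "(b, a) \<in> E" using ab by (auto simp: adj_iff)
    have V: "a \<in> pverts T" "b \<in> pverts T" using arc_verts[OF ab] by auto
    have hab: "(h a, h b) \<in> parcs T"
      using h ab by (auto simp: endomorphisms_def digraph_homs_def)
    consider "a \<in> branch v u \<longleftrightarrow> b \<in> branch v u" | "b \<notin> branch v u" "b = v"
      | "a \<notin> branch v u" "a = v"
      using branch_exit[OF vu _ E(1)] branch_exit[OF vu _ E(2)] by blast
    then show ?thesis using hab ab fixed g[OF V(1)] g[OF V(2)] by cases auto
  qed
  moreover have "g x \<in> pverts T" if "x \<in> pverts T" for x
    using h that by (auto simp: g endomorphisms_def digraph_homs_def)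
  moreover have "g x = undefined" if "x \<notin> pverts T" for x
    using that branch_subset_verts[OF vu] by (auto simp: g_def)
  ultimately have "g \<in> endomorphisms T"
    unfolding endomorphisms_def digraph_homs_def by (auto intro!: PiE_I)
  then show ?thesis unfolding g_def .
qed

lemma id_endo: "(\<lambda>x \<in> pverts T. x) \<in> endomorphisms T"
  using arc_verts by (fastforce simp: endomorphisms_def digraph_homs_def)

lemma core_imp_rigid:
  assumes core: "is_core T" and h: "h \<in> endomorphisms T"
  shows "h = (\<lambda>x \<in> pverts T. x)"
proof (rule ccontr)
  assume ne: "h \<noteq> (\<lambda>x \<in> pverts T. x)"
  have ext: "h \<in> extensional (pverts T)"
    using h by (auto simp: endomorphisms_def digraph_homs_def PiE_iff)
  obtain v0 where v0: "v0 \<in> pverts T" "h v0 = v0" using endo_fixes_vertex[OF h] by blast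
  \<comment> \<open>Otherwise the fixed vertices are closed under adjacency, hence all of
    \<open>T\<close>.\<close>
  have "\<exists>v u. h v = v \<and> (v, u) \<in> E \<and> h u \<noteq> u"
  proof (rule ccontr)
    assume "\<not> ?thesis"
    then have "pverts T \<subseteq> {v. h v = v}"
      using v0 connected[of v0 "{v. h v = v}"] by blast
    then show False
      using ne ext extensionalityI[OF ext restrict_extensional, of "\<lambda>x. x"] by auto
  qed
  then obtain v u where vu: "h v = v" "(v, u) \<in> E" "h u \<noteq> u" by blast
  let ?g = "\<lambda>x. if x \<in> branch v u then h x else (\<lambda>x \<in> pverts T. x) x"
  have u: "u \<in> pverts T" using vu(2) adj_verts2 by blast
  have vhu: "(v, h u) \<in> E" using endo_adj[OF h vu(2)] vu(1) by simp
  then have hu: "h u \<in> pverts T" "h u \<notin> branch v u"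
    using adj_verts2 branch_neighbour[OF vu(2)] vu(3) by blast+
  \<comment> \<open>As a neighbour of \<open>v\<close> other than \<open>u\<close>, the vertex
    \<open>h u\<close> lies outside the branch and stays put, while \<open>u\<close> is moved onto
    it.\<close>
  have "?g u = ?g (h u)" using hu branch_self by simp
  moreover have "inj_on ?g (pverts T)"
    using core fold_branch[OF h vu(2,1)] unfolding is_core_def by blast
  ultimately show False using u hu(1) vu(3) unfolding inj_on_def by metis
qed

section \<open>Arc consistency\<close>

lemma stable_list_element_attained:
  assumes stable: "\<not> (\<exists>L'. ac_step T H L L')"
    and L: "\<And>x. L x \<subseteq> pverts H"
    and x0: "x0 \<in> pverts T" and a: "a \<in> L x0"
  obtains f where "f \<in> digraph_homs T H" "f x0 = a"
proof -
  \<comment> \<open>Partial homomorphisms on connected vertex sets with values in the lists; a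
    largest such \<open>S\<close> will be all of \<open>T\<close>.\<close>
  define P where "P S f \<longleftrightarrow> S \<subseteq> pverts T \<and> x0 \<in> S \<and> f x0 = a \<and> (\<forall>x \<in> S. f x \<in> L x) \<and>
    (\<forall>u \<in> S. \<forall>v \<in> S. (u, v) \<in> parcs T \<longrightarrow> (f u, f v) \<in> parcs H) \<and>
    (\<forall>u \<in> S. \<forall>v \<in> S. (u, v) \<in> (Restr E S)\<^sup>*)" for S f
  have "P {x0} (\<lambda>_. a)" using x0 a asym by (auto simp: P_def)
  moreover have "card S \<le> card (pverts T)" if "P S f" for S f
    using that finite_verts by (auto simp: P_def intro: card_mono)
  ultimately obtain S where "\<exists>f. P S f" and max: "\<And>S' f'. P S' f' \<Longrightarrow> card S' \<le> card S"
    using ex_has_greatest_nat[of "\<lambda>S. \<exists>f. P S f" "{x0}" card "Suc (card (pverts T))"] by (metis less_Suc_eq_le)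
  then obtain f where P: "P S f" by blast
  have finS: "finite S" using P finite_verts finite_subset by (auto simp: P_def)
  have step: "t \<in> S" if s: "s \<in> S" and st: "(s, t) \<in> E" for s t
  proof (rule ccontr)
    assume t: "t \<notin> S"
    \<comment> \<open>Two neighbours of \<open>t\<close> in \<open>S\<close> are joined inside
      \<open>S\<close>, so avoiding \<open>t\<close>. Hence the value at \<open>t\<close> has to
      respect a single arc.\<close>
    have only: "s' = s" if "s' \<in> S" "(t, s') \<in> E" for s'
    proof (rule acyclic[OF adj_sym[OF st] that(2)])
      have "(s, s') \<in> (Restr E S)\<^sup>*" using P s that(1) by (simp add: P_def)
      moreover have "Restr E S \<subseteq> Restr E (- {t})" using t by blast
      ultimately show "(s, s') \<in> (Restr E (- {t}))\<^sup>*" using rtrancl_mono by blast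
    qed
    have fs: "f s \<in> L s" using P s by (simp add: P_def)
    \<comment> \<open>Only one direction is an arc; without a supporting \<open>b\<close>, a rule
      would remove \<open>f s\<close> from \<open>L s\<close>.\<close>
    obtain b where b: "b \<in> L t" "(s, t) \<in> parcs T \<Longrightarrow> (f s, b) \<in> parcs H"
      "(t, s) \<in> parcs T \<Longrightarrow> (b, f s) \<in> parcs H"
      using st asym stable ac_step.remove_tail[of s t T "f s" L H]
        ac_step.remove_head[of t s T "f s" L H] fs unfolding adj_iff by blast
    have tt: "(t, t) \<notin> parcs T" using asym by blast
    have arc: "((f(t := b)) u, (f(t := b)) v) \<in> parcs H"
      if "u \<in> insert t S" "v \<in> insert t S" "(u, v) \<in> parcs T" for u v
      using that P b only[of u] only[of v] tt t unfolding P_def adj_iff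
      by (cases "u = t"; cases "v = t") auto
    let ?R = "(Restr E (insert t S))\<^sup>*"
    have toS: "(u, v) \<in> ?R" if "u \<in> S" "v \<in> S" for u v
      using P that rtrancl_mono[of "Restr E S" "Restr E (insert t S)"] unfolding P_def by blast
    have stR: "(s, t) \<in> ?R" "(t, s) \<in> ?R" using s st adj_sym by blast+
    have conn: "(u, v) \<in> ?R" if "u \<in> insert t S" "v \<in> insert t S" for u v
      using that s toS stR by (metis insertE rtrancl.rtrancl_refl rtrancl_trans)
    have "P (insert t S) (f(t := b))"
      unfolding P_def
      using P b(1) t arc conn adj_verts2[OF st] by (auto simp: P_def)
    from max[OF this] show False using t finS by simp
  qed
  have sub: "S \<subseteq> pverts T" and inS: "x0 \<in> S" and f0: "f x0 = a"
    and fL: "\<forall>x \<in> S. f x \<in> L x"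
    and fE: "\<forall>u \<in> S. \<forall>v \<in> S. (u, v) \<in> parcs T \<longrightarrow> (f u, f v) \<in> parcs H"
    using P by (simp_all add: P_def)
  have "pverts T \<subseteq> S" using x0 inS step by (rule connected)
  with sub have V: "S = pverts T" by blast
  have "restrict f (pverts T) \<in> digraph_homs T H"
  proof -
    have "f x \<in> pverts H" if "x \<in> pverts T" for x using fL L[of x] that V by blast
    moreover have "(f u, f v) \<in> parcs H" if "(u, v) \<in> parcs T" for u v
      using fE arc_verts[OF that] that V by simp
    ultimately show ?thesis using arc_verts by (auto simp: digraph_homs_def)
  qed
  then show thesis using that[of "restrict f (pverts T)"] x0 f0 by simp
qed

text \<open>The singletons \<open>{h x}\<close> form a stable family, and stable families lie below
  all reachable ones.\<close>

lemma hom_in_list: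
  assumes h: "h \<in> digraph_homs T H" and L: "ac_reachable T H L" and x: "x \<in> pverts T"
  shows "h x \<in> L x"
proof -
  \<comment> \<open>Off the vertices \<open>h\<close> is \<open>undefined\<close>, so the empty set
    keeps \<open>?M x\<close> within \<open>pverts H\<close>.\<close>
  let ?M = "\<lambda>x. if x \<in> pverts T then {h x} else {}"
  have "\<not> (\<exists>M'. ac_step T H ?M M')"
    using h arc_verts by (force elim!: ac_step.cases simp: digraph_homs_def)
  moreover have "?M x \<subseteq> pverts H" for x
    using h by (auto simp: digraph_homs_def)
  ultimately have "?M x \<subseteq> L x" using L by (rule ac_stable_below_reachable)
  then show ?thesis using x by simp
qed

lemma pair_fin_digraph: "pair_fin_digraph T"
proof
  show "finite (pverts T)" by (rule finite_verts)
  have "parcs T \<subseteq> pverts T \<times> pverts T" using arc_verts by auto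
  then show "finite (parcs T)" using finite_verts finite_subset by blast
qed (use arc_verts in auto)

lemma rigid_iff_ac_singletons:
  "endomorphisms T = {\<lambda>x \<in> pverts T. x} \<longleftrightarrow>
     (\<exists>L. ac_terminates_with T T L \<and> (\<forall>x \<in> pverts T. card (L x) = 1))" (is "?rigid \<longleftrightarrow> ?ac")
proof
  assume rigid: ?rigid
  \<comment> \<open>The identity is an endomorphism, so no list can become empty.\<close>
  have self: "x \<in> L x" if "ac_reachable T T L" "x \<in> pverts T" for L x
    using hom_in_list[OF _ that, of "\<lambda>x \<in> pverts T. x"] id_endo that
    by (simp add: endomorphisms_def)
  then have "\<not> ac_rejects T T" unfolding ac_rejects_def by blast
  then obtain L where L: "ac_terminates_with T T L"
    using ac_halts[OF pair_fin_digraph finite_verts] by blast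
  then have reach: "ac_reachable T T L" and stable: "\<not> (\<exists>L'. ac_step T T L L')"
    unfolding ac_terminates_with_def by auto
  have "L x = {x}" if x: "x \<in> pverts T" for x
  proof -
    have "a = x" if "a \<in> L x" for a
      using stable_list_element_attained[OF stable ac_reachable_subset[OF reach] x that] rigid x
      by (metis endomorphisms_def restrict_apply' singletonD)
    then show ?thesis using self[OF reach x] by blast
  qed
  then show ?ac using L by auto
next
  assume ?ac
  then obtain L where L: "ac_reachable T T L" "\<And>x. x \<in> pverts T \<Longrightarrow> card (L x) = 1"
    unfolding ac_terminates_with_def by blast
  have "h = (\<lambda>x \<in> pverts T. x)" if h: "h \<in> endomorphisms T" for h
  proof (rule extensionalityI[of _ "pverts T"])
    show "h \<in> extensional (pverts T)"
      using h by (auto simp: endomorphisms_def digraph_homs_def PiE_iff)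
    fix x assume x: "x \<in> pverts T"
    have "h x \<in> L x" "(\<lambda>x \<in> pverts T. x) x \<in> L x"
      using hom_in_list[OF _ L(1) x] h id_endo unfolding endomorphisms_def by blast+
    then show "h x = (\<lambda>x \<in> pverts T. x) x"
      using L(2)[OF x] card_1_singletonE by (metis singletonD)
  qed simp
  then show ?rigid using id_endo by blast
qed

lemma core_iff_rigid: "is_core T \<longleftrightarrow> endomorphisms T = {\<lambda>x \<in> pverts T. x}"
  using core_imp_rigid id_endo by (auto simp: is_core_def inj_on_def)

end

section \<open>Undirected trees\<close>

text \<open>Shortening a walk to a path uses only arcs of the walk, so \<open>x\<close> is still
  avoided.\<close>

lemma (in pair_wf_digraph) avoiding_path:
  assumes "(y, a) \<in> (Restr (parcs G) (- {x}))\<^sup>*" "y \<in> pverts G" "y \<noteq> x"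
  obtains p where "apath y p a" "x \<notin> set (awalk_verts y p)"
proof -
  from assms(1) have "\<exists>p. awalk y p a \<and> (\<forall>e \<in> set p. fst e \<noteq> x \<and> snd e \<noteq> x)"
  proof (induction rule: rtrancl_induct)
    case base
    then show ?case using assms(2) by (intro exI[of _ "[]"]) (simp add: awalk_Nil_iff)
  next
    case (step b c)
    then obtain p where "awalk y p b" "\<forall>e \<in> set p. fst e \<noteq> x \<and> snd e \<noteq> x" by blast
    with step.hyps(2) show ?case
      by (intro exI[of _ "p @ [(b, c)]"]) (auto simp: awalk_simps in_arcsD1 in_arcsD2)
  qed
  then obtain p where p: "awalk y p a" "\<forall>e \<in> set p. fst e \<noteq> x \<and> snd e \<noteq> x" by blast
  let ?q = "awalk_to_apath p"
  have q: "apath y ?q a" using p(1) by (rule apath_awalk_to_apath)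
  then have "awalk y ?q a" by (rule awalkI_apath)
  then have "x \<notin> set (awalk_verts y ?q)"
    using awalk_to_apath_subset[OF p(1)] p(2) assms(3) by (auto simp: set_awalk_verts)
  with q that show thesis by blast
qed

text \<open>If \<open>a \<noteq> y\<close>, a path from \<open>y\<close> to \<open>a\<close>
  avoiding \<open>x\<close> closes up through \<open>x\<close> to a cycle; the path being nonempty,
  its length is at least three.\<close>

lemma undirected_tree_acyclic:
  assumes U: "undirected_tree U"
    and xy: "(x, y) \<in> parcs U" and xa: "(x, a) \<in> parcs U"
    and ya: "(y, a) \<in> (Restr (parcs U) (- {x}))\<^sup>*"
  shows "a = y"
proof (rule ccontr)
  assume "a \<noteq> y"
  interpret pair_graph U using U unfolding undirected_tree_def by blast
  have V: "x \<in> pverts U" "y \<in> pverts U" using xy in_arcsD1 in_arcsD2 by blast+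
  obtain p where p: "apath y p a" "x \<notin> set (awalk_verts y p)"
    using avoiding_path[OF ya V(2)] no_loops'[OF xy] by blast
  have w: "awalk y p a" using p(1) by (rule awalkI_apath)
  have "p \<noteq> []" using w \<open>a \<noteq> y\<close> by (auto simp: awalk_Nil_iff)
  have ax: "(a, x) \<in> parcs U" using xa by (rule arcs_symmetric)
  let ?c = "(x, y) # p @ [(a, x)]"
  have "awalk x ?c x" using w xy ax V by (auto simp: awalk_simps)
  moreover have "distinct (tl (awalk_verts x ?c))"
    using p w awalk_verts_append[of y p "[(a, x)]" x] ax V by (auto simp: apath_def awalk_simps)
  ultimately have "cycle ?c" unfolding cycle_def by blast
  moreover have "length ?c \<ge> 3" using \<open>p \<noteq> []\<close> by (cases p) auto
  ultimately show False using U unfolding undirected_tree_def by blast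
qed

lemma undirected_tree_connected:
  assumes U: "undirected_tree U" and u: "u \<in> pverts U" "u \<in> S"
    and closed: "\<And>v w. v \<in> S \<Longrightarrow> (v, w) \<in> parcs U \<Longrightarrow> w \<in> S"
  shows "pverts U \<subseteq> S"
proof
  interpret pair_graph U using U unfolding undirected_tree_def by blast
  fix v assume v: "v \<in> pverts U"
  \<comment> \<open>Symmetry of \<open>U\<close> turns connectedness into reachability along its own
    arcs.\<close>
  have "strongly_connected (with_proj U)"
    using U symmetric_connected_imp_strongly_connected[OF sym_arcs]
    unfolding undirected_tree_def by blast
  then have "(u, v) \<in> rtrancl_on (pverts U) (parcs U)"
    using u(1) v by (simp add: strongly_connected_def reachable_def)
  then show "v \<in> S"
    by (induction rule: rtrancl_on_induct) (use u closed in auto)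
qed

lemma oriented_tree_graphI:
  assumes U: "undirected_tree U" and T: "orientation_of T U"
  shows "oriented_tree_graph T (parcs U)"
proof -
  interpret pair_graph U using U unfolding undirected_tree_def by blast
  have V: "pverts T = pverts U" and sub: "parcs T \<subseteq> parcs U"
    and xor: "\<And>u v. (u, v) \<in> parcs U \<Longrightarrow> (u, v) \<in> parcs T \<longleftrightarrow> (v, u) \<notin> parcs T"
    using T unfolding orientation_of_def by auto
  show ?thesis
  proof
    show "finite (pverts T)" using V pair_finite_verts by simp
    show "pverts T \<noteq> {}"
      using U V by (auto simp: undirected_tree_def connected_def strongly_connected_def)
    show "(u, v) \<in> parcs U \<longleftrightarrow> (u, v) \<in> parcs T \<or> (v, u) \<in> parcs T" for u v
      using sub xor arcs_symmetric by blast
    show "u \<in> pverts T" if "(u, v) \<in> parcs U" for u v using that V in_arcsD1 by simp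
    show "(v, u) \<notin> parcs T" if "(u, v) \<in> parcs T" for u v using that sub xor by blast
    show "pverts T \<subseteq> S"
      if "u \<in> pverts T" "u \<in> S" "\<And>v w. v \<in> S \<Longrightarrow> (v, w) \<in> parcs U \<Longrightarrow> w \<in> S" for u S
      using undirected_tree_connected[OF U, of u S] that V by blast
    show "a = y" if "(x, y) \<in> parcs U" "(x, a) \<in> parcs U"
      "(y, a) \<in> (Restr (parcs U) (- {x}))\<^sup>*" for x y a
      using undirected_tree_acyclic[OF U that] .
  qed
qed

theorem theorem2:
  fixes T :: "'a pair_pre_digraph"
  assumes "oriented_tree T"
  shows "(is_core T \<longleftrightarrow> endomorphisms T = {\<lambda>x \<in> pverts T. x}) \<and>
         (endomorphisms T = {\<lambda>x \<in> pverts T. x} \<longleftrightarrow>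
            (\<exists>L. ac_terminates_with T T L \<and> (\<forall>x \<in> pverts T. card (L x) = 1)))"
proof -
  obtain U where "undirected_tree U" "orientation_of T U"
    using assms unfolding oriented_tree_def by blast
  then interpret oriented_tree_graph T "parcs U" by (rule oriented_tree_graphI)
  show ?thesis using core_iff_rigid rigid_iff_ac_singletons by blast
qed

end
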